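(* For any regular path in the moment space, that is, a path living in the cone $|q/(M_0e)|\le\eta$ of the $(e,q)$ plane and reaching smoothly the point $(e,q)=(0,0)$, the flux $\mathbf{F}(\mathbf{M})$ is continuous up to the frontier of the moment space and $\mathcal{C}^1$ at $(0,0)$ in any direction inside this cone.
   Context: Moment space: $\Omega=\{\mathbf{M}=(M_0,M_1,M_2,M_3)^t\in\mathbb{R}^4: M_0>0,\ M_0M_2-M_1^2>0\}$; its frontier (with $M_0>0$) is the set where $M_0>0$ and $M_0M_2-M_1^2=0$. For each $\mathbf{M}\in\Omega$ there are unique $\rho_1,\rho_2>0$ and $v_1>v_2$ with $M_i=\rho_1v_1^i+\rho_2v_2^i$ for $i=0,1,2,3$. The flux is $\mathbf{F}(\mathbf{M})=(M_1,M_2,M_3,\overline{M_4})^t$ with $\overline{M_4}=\rho_1v_1^4+\rho_2v_2^4$. Put $e=M_0M_2-M_1^2$ and $q=(M_3M_0^2-M_1^3)-3M_1(M_0M_2-M_1^2)$, so that $(M_0,M_1,e,q)$ can be used as variables in place of $(M_0,M_1,M_2,M_3)$ and the frontier is $\{M_0>0,\ e=0\}$. A regular path is a path in the moment space parametrized by $x$, $\mathbf{M}_x=(M_{0\,x},M_{1\,x},M_{2\,x},M_{3\,x})$, which admits a limit $\mathbf{M}_0$ as $x$ goes to zero and is at least $\mathcal{C}^1$ up to this limit, and such that, with $e_x,q_x$ the values of $e,q$ at $\mathbf{M}_x$: $e_{x=0}=0$; $e_x>0$ for $x>0$; $M_{0\,x}>\nu>0$; and $|q_x/(M_{0\,x}\,e_x)|\le\eta$,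 where $\eta>0$. (For such a path $q_x\to0$ as $x\to0$, so the path does reach $(e,q)=(0,0)$.) *)

theory Defs
  imports "HOL-Analysis.Analysis"
begin

text \<open>
  The index type \<^typ>\<open>4\<close> is the integers modulo 4, so its elements are 0, 1, 2, 3 and the
  moment \<open>M\<^sub>i\<close> is simply \<open>M $ i\<close>. (The library writes the same components as
  \<open>M $ 1, \<dots>, M $ 4\<close>, where \<open>4 = 0\<close>.)
\<close>

definition moment_space :: "(real^4) set" where
  "moment_space = {M. M $ 0 > 0 \<and> M $ 0 * M $ 2 - (M $ 1)^2 > 0}"

definition quadrature :: "real^4 \<Rightarrow> real \<Rightarrow> real \<Rightarrow> real \<Rightarrow> real \<Rightarrow> bool" where
  "quadrature M \<rho>1 \<rho>2 v1 v2 \<longleftrightarrow>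
     \<rho>1 > 0 \<and> \<rho>2 > 0 \<and> v1 > v2 \<and>
     (\<forall>i::nat<4. M $ of_nat i = \<rho>1 * v1 ^ i + \<rho>2 * v2 ^ i)"

lemma quadrature_iff:
  "quadrature M \<rho>1 \<rho>2 v1 v2 \<longleftrightarrow>
     \<rho>1 > 0 \<and> \<rho>2 > 0 \<and> v1 > v2 \<and>
     M $ 0 = \<rho>1 + \<rho>2 \<and> M $ 1 = \<rho>1 * v1 + \<rho>2 * v2 \<and>
     M $ 2 = \<rho>1 * v1^2 + \<rho>2 * v2^2 \<and> M $ 3 = \<rho>1 * v1^3 + \<rho>2 * v2^3"
proof -
  have "(\<forall>i::nat<4. P i) \<longleftrightarrow> P 0 \<and> P 1 \<and> P 2 \<and> P 3" for P
    by (auto simp: numeral_eq_Suc less_Suc_eq)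
  then show ?thesis by (auto simp: quadrature_def)
qed

lemma quadrature_exists:
  assumes "M \<in> moment_space"
  shows "\<exists>\<rho>1 \<rho>2 v1 v2. quadrature M \<rho>1 \<rho>2 v1 v2"
proof -
  define m0 m1 m2 m3 where m: "m0 = M $ 0" "m1 = M $ 1" "m2 = M $ 2" "m3 = M $ 3"
  define e where "e = m0 * m2 - m1^2"
  have pos: "m0 > 0" "e > 0" using assms by (auto simp: moment_space_def m e_def)
  define s where "s = (m0 * m3 - m1 * m2) / e"
  define p where "p = (m1 * m3 - m2^2) / e"
  have es: "e * s = m0 * m3 - m1 * m2" and ep: "e * p = m1 * m3 - m2^2"
    using pos by (auto simp: s_def p_def)
  have "e * (s * m1 - p * m0) = (e * s) * m1 - (e * p) * m0" by (simp add: algebra_simps)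
  also have "\<dots> = e * m2"
    unfolding es ep by (simp add: e_def power2_eq_square algebra_simps)
  finally have "e * (s * m1 - p * m0) = e * m2" .
  then have rec2: "m2 = s * m1 - p * m0" using pos by simp
  have "e * (s * m2 - p * m1) = (e * s) * m2 - (e * p) * m1" by (simp add: algebra_simps)
  also have "\<dots> = e * m3"
    unfolding es ep by (simp add: e_def power2_eq_square algebra_simps)
  finally have "e * (s * m2 - p * m1) = e * m3" .
  then have rec3: "m3 = s * m2 - p * m1" using pos by simp
  have "(2 * m1 - s * m0)^2 = m0^2 * (s^2 - 4 * p) - 4 * e"
    by (simp add: rec2 e_def power2_eq_square algebra_simps)
  then have disc: "m0^2 * (s^2 - 4 * p) = (2 * m1 - s * m0)^2 + 4 * e" by simp
  then have "m0^2 * (s^2 - 4 * p) > 0" using pos by (simp add: add_nonneg_pos)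
  then have dpos: "s^2 - 4 * p > 0" using pos by (simp add: zero_less_mult_iff)
  define r where "r = sqrt (s^2 - 4 * p)"
  have r: "r > 0" "r^2 = s^2 - 4 * p" using dpos by (auto simp: r_def)
  have "\<bar>2 * m1 - s * m0\<bar>^2 < (m0 * r)^2"
    using disc r pos by (simp add: power_mult_distrib)
  then have "\<bar>2 * m1 - s * m0\<bar> < m0 * r"
    by (rule power_less_imp_less_base) (use r pos in simp)
  then have bd: "2 * m1 - s * m0 < m0 * r" "- (2 * m1 - s * m0) < m0 * r" by auto
  define v1 v2 where v: "v1 = (s + r) / 2" "v2 = (s - r) / 2"
  have vs: "s = v1 + v2" and vr: "r = v1 - v2" by (auto simp: v field_simps)
  have "4 * p = 4 * (v1 * v2)"
    using r(2) by (simp add: v field_simps power2_eq_square)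
  then have vp: "p = v1 * v2" by simp
  define \<rho>1 \<rho>2 where \<rho>: "\<rho>1 = (m1 - v2 * m0) / r" "\<rho>2 = (v1 * m0 - m1) / r"
  have r\<rho>: "r * \<rho>1 = m1 - v2 * m0" "r * \<rho>2 = v1 * m0 - m1" using r by (auto simp: \<rho>)
  have "\<rho>1 > 0" "\<rho>2 > 0" using bd r by (auto simp: \<rho> v field_simps)
  moreover have "v1 > v2" using r vr by simp
  moreover have m0: "m0 = \<rho>1 + \<rho>2"
  proof -
    have "r * (\<rho>1 + \<rho>2) = r * \<rho>1 + r * \<rho>2" by (simp add: algebra_simps)
    also have "\<dots> = r * m0" unfolding r\<rho> by (simp add: vr algebra_simps)
    finally have "r * (\<rho>1 + \<rho>2) = r * m0" .
    then show ?thesis using r by simp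
  qed
  moreover have m1: "m1 = \<rho>1 * v1 + \<rho>2 * v2"
  proof -
    have "r * (\<rho>1 * v1 + \<rho>2 * v2) = (r * \<rho>1) * v1 + (r * \<rho>2) * v2"
      by (simp add: algebra_simps)
    also have "\<dots> = r * m1" unfolding r\<rho> by (simp add: vr algebra_simps)
    finally have "r * (\<rho>1 * v1 + \<rho>2 * v2) = r * m1" .
    then show ?thesis using r by simp
  qed
  moreover have m2: "m2 = \<rho>1 * v1^2 + \<rho>2 * v2^2" unfolding rec2 m0 m1
    by (simp add: vs vp power2_eq_square power3_eq_cube algebra_simps)
  moreover have "m3 = \<rho>1 * v1^3 + \<rho>2 * v2^3" unfolding rec3 m1 m2
    by (simp add: vs vp power2_eq_square power3_eq_cube algebra_simps)
  ultimately show ?thesis unfolding quadrature_iff m by metis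
qed

lemma quadrature_unique:
  assumes "quadrature M \<rho>1 \<rho>2 v1 v2" "quadrature M \<sigma>1 \<sigma>2 w1 w2"
  shows "\<rho>1 = \<sigma>1 \<and> \<rho>2 = \<sigma>2 \<and> v1 = w1 \<and> v2 = w2"
proof -
  note A = assms[unfolded quadrature_iff]
  define m0 m1 m2 m3 where m: "m0 = M $ 0" "m1 = M $ 1" "m2 = M $ 2" "m3 = M $ 3"
  define e where "e = m0 * m2 - m1^2"
  have eqs: "m0 = \<rho>1 + \<rho>2" "m1 = \<rho>1 * v1 + \<rho>2 * v2" "m2 = \<rho>1 * v1^2 + \<rho>2 * v2^2"
      "m3 = \<rho>1 * v1^3 + \<rho>2 * v2^3"
    and eqs': "m0 = \<sigma>1 + \<sigma>2" "m1 = \<sigma>1 * w1 + \<sigma>2 * w2" "m2 = \<sigma>1 * w1^2 + \<sigma>2 * w2^2"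
      "m3 = \<sigma>1 * w1^3 + \<sigma>2 * w2^3"
    using A by (auto simp: m)
  have "e = \<rho>1 * \<rho>2 * (v1 - v2)^2" 
    by (simp add: eqs e_def power2_eq_square power3_eq_cube algebra_simps)
  then have e0: "e \<noteq> 0" using A by auto
  have "e * (v1 + v2) = m0 * m3 - m1 * m2" 
    by (simp add: eqs e_def power2_eq_square power3_eq_cube algebra_simps)
  moreover have "e * (w1 + w2) = m0 * m3 - m1 * m2" 
    by (simp add: eqs' e_def power2_eq_square power3_eq_cube algebra_simps)
  ultimately have s: "v1 + v2 = w1 + w2" using e0 by (metis mult_left_cancel)
  have "e * (v1 * v2) = m1 * m3 - m2^2" 
    by (simp add: eqs e_def power2_eq_square power3_eq_cube algebra_simps)
  moreover have "e * (w1 * w2) = m1 * m3 - m2^2" 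
    by (simp add: eqs' e_def power2_eq_square power3_eq_cube algebra_simps)
  ultimately have "v1 * v2 = w1 * w2" using e0 by (metis mult_left_cancel)
  then have "(v1 + v2)^2 - 4 * (v1 * v2) = (w1 + w2)^2 - 4 * (w1 * w2)" using s by simp
  then have "(v1 - v2)^2 = (w1 - w2)^2" by (simp add: power2_eq_square algebra_simps)
  then have "v1 - v2 = w1 - w2" using A by (smt (verit) power2_eq_iff_nonneg)
  then have v: "v1 = w1" "v2 = w2" using s by auto
  have "(v1 - v2) * \<rho>1 = m1 - v2 * m0" by (simp add: eqs algebra_simps)
  moreover have "(v1 - v2) * \<sigma>1 = m1 - v2 * m0" by (simp add: eqs' v algebra_simps)
  ultimately have "\<rho>1 = \<sigma>1" using A by (metis mult_left_cancel diff_gt_0_iff_gt less_irrefl)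
  then show ?thesis using v eqs(1) eqs'(1) by simp
qed

text \<open>
  Well defined on the moment space by \<open>quadrature_exists\<close> and \<open>quadrature_unique\<close>; its value
  elsewhere is irrelevant.
\<close>

definition M4_bar :: "real^4 \<Rightarrow> real" where
  "M4_bar M = (THE m. \<exists>\<rho>1 \<rho>2 v1 v2. quadrature M \<rho>1 \<rho>2 v1 v2 \<and> m = \<rho>1 * v1 ^ 4 + \<rho>2 * v2 ^ 4)"

definition flux :: "real^4 \<Rightarrow> real^4" where
  "flux M = (\<chi> i. if i = 3 then M4_bar M else M $ (i + 1))"

definition e_var :: "real^4 \<Rightarrow> real" where
  "e_var M = M $ 0 * M $ 2 - (M $ 1)^2"

definition q_var :: "real^4 \<Rightarrow> real" where
  "q_var M = (M $ 3 * (M $ 0)^2 - (M $ 1)^3) - 3 * M $ 1 * (M $ 0 * M $ 2 - (M $ 1)^2)"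

text \<open>
  The moment vector with prescribed \<open>(M\<^sub>0, M\<^sub>1, e, q)\<close>, obtained by solving the definitions
  of \<open>e\<close> and \<open>q\<close> for \<open>M\<^sub>2\<close> and \<open>M\<^sub>3\<close>; see \<open>from_eq_iff\<close>.
\<close>

definition from_eq :: "real \<Rightarrow> real \<Rightarrow> real \<Rightarrow> real \<Rightarrow> real^4" where
  "from_eq m0 m1 e q =
     (\<chi> i. if i = 0 then m0
           else if i = 1 then m1
           else if i = 2 then (e + m1^2) / m0
           else (q + m1^3 + 3 * m1 * e) / m0^2)"

lemma all_4_iff: "(\<forall>i::4. P i) \<longleftrightarrow> P 0 \<and> P 1 \<and> P 2 \<and> P 3"
proof -
  have "(4::4) = 0" by simp
  then show ?thesis by (metis forall_4)
qed

lemma from_eq_iff: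
  assumes "m0 > 0"
  shows "M = from_eq m0 m1 e q \<longleftrightarrow> M $ 0 = m0 \<and> M $ 1 = m1 \<and> e_var M = e \<and> q_var M = q"
proof -
  have "M $ 2 = (e + m1^2) / m0 \<and> M $ 3 = (q + m1^3 + 3 * m1 * e) / m0^2
      \<longleftrightarrow> e_var M = e \<and> q_var M = q" if "M $ 0 = m0" "M $ 1 = m1"
  proof -
    have "M $ 2 = (e + m1^2) / m0 \<longleftrightarrow> e_var M = e"
      using assms that by (auto simp: e_var_def field_simps)
    moreover have "M $ 3 = (q + m1^3 + 3 * m1 * e) / m0^2 \<longleftrightarrow> q_var M = q" if "e_var M = e"
      using assms that \<open>M $ 0 = m0\<close> \<open>M $ 1 = m1\<close>
      unfolding q_var_def e_var_def[symmetric] by (auto simp: field_simps)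
    ultimately show ?thesis by blast
  qed
  then show ?thesis by (auto simp: vec_eq_iff all_4_iff from_eq_def)
qed

text \<open>Continuously differentiable up to the end points of \<open>S\<close> (one-sided derivatives there).\<close>

definition C1_on :: "real set \<Rightarrow> (real \<Rightarrow> 'a::real_normed_vector) \<Rightarrow> bool" where
  "C1_on S f \<longleftrightarrow>
     (\<exists>f'. continuous_on S f' \<and> (\<forall>x\<in>S. (f has_vector_derivative f' x) (at x within S)))"

text \<open>The value \<open>M 0\<close> is the limit of the path as \<open>x\<close> goes to zero.\<close>

definition regular_path :: "real \<Rightarrow> real \<Rightarrow> (real \<Rightarrow> real^4) \<Rightarrow> bool" where
  "regular_path \<eta> X M \<longleftrightarrow>
     \<eta> > 0 \<and> X > 0 \<and> C1_on {0..X} M \<and>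
     (\<forall>x\<in>{0<..X}. M x \<in> moment_space) \<and>
     e_var (M 0) = 0 \<and>
     (\<forall>x\<in>{0<..X}. e_var (M x) > 0) \<and>
     (\<exists>\<nu>>0. \<forall>x\<in>{0..X}. M x $ 0 > \<nu>) \<and>
     (\<forall>x\<in>{0<..X}. \<bar>q_var (M x) / (M x $ 0 * e_var (M x))\<bar> \<le> \<eta>)"

end

theory Submission
  imports Defs
begin

text \<open>
  Expressing the fourth moment of two point masses through the mean and the centred moments gives
  \<open>M0^3 * M4 = e^2 + q^2 / e + 4 * M1 * q + 6 * M1^2 * e + M1^4\<close>, so only \<open>q^2 / e\<close> is singular on
  the frontier. Along a path with \<open>|q| \<le> K * e\<close> its derivative is \<open>2 * r * q' - r^2 * e'\<close> with
  \<open>r = q / e\<close> bounded. If \<open>e'(0) \<noteq> 0\<close> then \<open>r\<close> converges; if \<open>e'(0) = 0\<close> then the cone condition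
  forces \<open>q'(0) = 0\<close>, and boundedness of \<open>r\<close> is enough.
\<close>

section \<open>Closure properties of \<open>C1_on\<close>\<close>

lemma C1_on_imp_continuous_on: "C1_on S f \<Longrightarrow> continuous_on S f"
  unfolding C1_on_def continuous_on_eq_continuous_within
  by (meson has_vector_derivative_continuous)

lemma C1_on_const: "C1_on S (\<lambda>x. c)"
  unfolding C1_on_def by (intro exI[of _ "\<lambda>_. 0"]) auto

lemma C1_on_ident: "C1_on S (\<lambda>x. x)"
  unfolding C1_on_def
  by (intro exI[of _ "\<lambda>_. 1"]) (auto intro!: derivative_eq_intros)

lemma C1_on_cong:
  assumes "C1_on S f" "\<And>x. x \<in> S \<Longrightarrow> f x = g x"
  shows "C1_on S g"
  using assms unfolding C1_on_def by (metis has_vector_derivative_transform)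

lemma C1_on_add:
  assumes "C1_on S f" "C1_on S g"
  shows "C1_on S (\<lambda>x. f x + g x)"
proof -
  obtain f' g' where "continuous_on S f'" "continuous_on S g'"
    "\<forall>x\<in>S. (f has_vector_derivative f' x) (at x within S)"
    "\<forall>x\<in>S. (g has_vector_derivative g' x) (at x within S)"
    using assms unfolding C1_on_def by blast
  then show ?thesis unfolding C1_on_def
    by (intro exI[of _ "\<lambda>x. f' x + g' x"])
       (auto intro!: continuous_intros has_vector_derivative_add)
qed

lemma C1_on_bounded_linear:
  assumes "bounded_linear h" "C1_on S f"
  shows "C1_on S (\<lambda>x. h (f x))"
proof -
  obtain f' where "continuous_on S f'"
    "\<forall>x\<in>S. (f has_vector_derivative f' x) (at x within S)"
    using assms unfolding C1_on_def by blast
  then show ?thesis unfolding C1_on_def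
    by (intro exI[of _ "\<lambda>x. h (f' x)"])
       (auto intro!: bounded_linear.continuous_on[OF assms(1)]
          bounded_linear.has_vector_derivative[OF assms(1)])
qed

lemma C1_on_sum:
  assumes "finite I" "\<And>i. i \<in> I \<Longrightarrow> C1_on S (f i)"
  shows "C1_on S (\<lambda>x. \<Sum>i\<in>I. f i x)"
  using assms by (induction I rule: finite_induct) (auto intro: C1_on_const C1_on_add)

lemma C1_on_mult:
  fixes f g :: "real \<Rightarrow> real"
  assumes "C1_on S f" "C1_on S g"
  shows "C1_on S (\<lambda>x. f x * g x)"
proof -
  have cont: "continuous_on S f" "continuous_on S g"
    using assms by (auto intro: C1_on_imp_continuous_on)
  obtain f' g' where "continuous_on S f'" "continuous_on S g'"
    "\<forall>x\<in>S. (f has_vector_derivative f' x) (at x within S)"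
    "\<forall>x\<in>S. (g has_vector_derivative g' x) (at x within S)"
    using assms unfolding C1_on_def by blast
  then show ?thesis using cont unfolding C1_on_def
    by (intro exI[of _ "\<lambda>x. f x * g' x + f' x * g x"])
       (auto intro!: continuous_intros has_vector_derivative_mult)
qed

lemma C1_on_diff:
  fixes f g :: "real \<Rightarrow> real"
  assumes "C1_on S f" "C1_on S g"
  shows "C1_on S (\<lambda>x. f x - g x)"
  using C1_on_add[OF assms(1) C1_on_mult[OF C1_on_const[of S "-1"] assms(2)]] by simp

lemma C1_on_power:
  fixes f :: "real \<Rightarrow> real"
  assumes "C1_on S f"
  shows "C1_on S (\<lambda>x. f x ^ n)"
  by (induction n) (auto intro: C1_on_const C1_on_mult assms)

lemma C1_on_inverse:
  fixes f :: "real \<Rightarrow> real"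
  assumes "C1_on S f" "\<And>x. x \<in> S \<Longrightarrow> f x \<noteq> 0"
  shows "C1_on S (\<lambda>x. inverse (f x))"
proof -
  obtain f' where f': "continuous_on S f'"
    "\<And>x. x \<in> S \<Longrightarrow> (f has_real_derivative f' x) (at x within S)"
    using assms unfolding C1_on_def has_real_derivative_iff_has_vector_derivative by blast
  have "((\<lambda>x. inverse (f x)) has_real_derivative - (inverse (f x) * f' x * inverse (f x)))
      (at x within S)" if "x \<in> S" for x
    by (rule DERIV_inverse'[OF f'(2)]) (use that assms in auto)
  then show ?thesis
    using assms(2) f'(1) C1_on_imp_continuous_on[OF assms(1)]
    unfolding C1_on_def has_real_derivative_iff_has_vector_derivative
    by (intro exI[of _ "\<lambda>x. - (inverse (f x) * f' x * inverse (f x))"])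
       (auto intro!: continuous_intros)
qed

lemma C1_on_divide:
  fixes f g :: "real \<Rightarrow> real"
  assumes "C1_on S f" "C1_on S g" "\<And>x. x \<in> S \<Longrightarrow> g x \<noteq> 0"
  shows "C1_on S (\<lambda>x. f x / g x)"
  unfolding divide_inverse using assms by (intro C1_on_mult C1_on_inverse) auto

lemmas C1_on_intros = C1_on_const C1_on_ident C1_on_add C1_on_diff C1_on_mult C1_on_power C1_on_divide

text \<open>For the reverse direction \<open>f\<close> is recombined from its coordinates along the
  standard basis. Regularity of the flux thus reduces to real-valued functions.\<close>

lemma C1_on_vec_iff:
  fixes f :: "real \<Rightarrow> real^'n"
  shows "C1_on S f \<longleftrightarrow> (\<forall>i. C1_on S (\<lambda>x. f x $ i))"
proof (intro iffI allI)
  show "C1_on S (\<lambda>x. f x $ i)" if "C1_on S f" for i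
    using bounded_linear_vec_nth that by (rule C1_on_bounded_linear)
  assume "\<forall>i. C1_on S (\<lambda>x. f x $ i)"
  then have "C1_on S (\<lambda>x. \<Sum>i\<in>UNIV. (f x $ i) *\<^sub>R (axis i 1 :: real^'n))"
    by (intro C1_on_sum C1_on_bounded_linear[OF bounded_linear_scaleR_left]) auto
  then show "C1_on S f"
    by (rule C1_on_cong) (simp add: basis_expansion scalar_mult_eq_scaleR[symmetric])
qed

section \<open>The singular quotient \<open>q^2 / e\<close> up to the end point\<close>

lemma C1_on_square_divide:
  fixes e q :: "real \<Rightarrow> real"
  assumes X: "X > 0" and C1: "C1_on {0..X} e" "C1_on {0..X} q"
    and e0: "e 0 = 0" and e_pos: "\<And>x. x \<in> {0<..X} \<Longrightarrow> e x > 0"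
    and cone: "\<And>x. x \<in> {0<..X} \<Longrightarrow> \<bar>q x\<bar> \<le> K * e x"
  shows "C1_on {0..X} (\<lambda>x. (q x)^2 / e x)"
proof -
  let ?F = "at 0 within {0..X}"
  have cont: "continuous_on {0..X} e" "continuous_on {0..X} q"
    using C1 by (auto intro: C1_on_imp_continuous_on)
  obtain e' q' where c': "continuous_on {0..X} e'" "continuous_on {0..X} q'"
    and de: "\<And>x. x \<in> {0..X} \<Longrightarrow> (e has_real_derivative e' x) (at x within {0..X})"
    and dq: "\<And>x. x \<in> {0..X} \<Longrightarrow> (q has_real_derivative q' x) (at x within {0..X})"
    using C1 unfolding C1_on_def has_real_derivative_iff_has_vector_derivative by metis
  have nontriv: "?F \<noteq> bot"
    using X by (simp add: trivial_limit_within islimpt_Icc)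
  \<comment> \<open>\<open>?F\<close> ignores the point 0 itself, so a property that holds on
    \<open>{0<..X}\<close> holds eventually.\<close>
  have ev: "eventually P ?F" if "\<And>x. x \<in> {0<..X} \<Longrightarrow> P x" for P
    using that by (auto simp: eventually_at_filter)
  have lims: "(e \<longlongrightarrow> 0) ?F" "(q \<longlongrightarrow> q 0) ?F"
    using cont[unfolded continuous_on_def, THEN bspec, of 0] X e0 by auto
  have "\<bar>q 0\<bar> \<le> K * 0"
    by (rule tendsto_le[OF nontriv tendsto_mult_left[OF lims(1)] tendsto_rabs[OF lims(2)]])
       (rule ev, rule cone)
  then have q0: "q 0 = 0" by simp
  have le: "((\<lambda>x. e x / x) \<longlongrightarrow> e' 0) ?F" and lq: "((\<lambda>x. q x / x) \<longlongrightarrow> q' 0) ?F"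
    using de[of 0] dq[of 0] X by (auto simp: has_field_derivative_iff e0 q0)
  \<comment> \<open>Dividing the cone condition by \<open>x\<close> and letting \<open>x\<close>
    tend to 0 transfers it to the derivatives.\<close>
  have "\<bar>q' 0\<bar> \<le> K * e' 0"
  proof (rule tendsto_le[OF nontriv])
    show "((\<lambda>x. K * (e x / x)) \<longlongrightarrow> K * e' 0) ?F" using le by (rule tendsto_mult_left)
    show "((\<lambda>x. \<bar>q x / x\<bar>) \<longlongrightarrow> \<bar>q' 0\<bar>) ?F" using lq by (rule tendsto_rabs)
    show "\<forall>\<^sub>F x in ?F. \<bar>q x / x\<bar> \<le> K * (e x / x)"
      using cone by (auto intro!: ev simp: abs_divide divide_right_mono)
  qed
  then have q'0: "q' 0 = 0" if "e' 0 = 0" using that by simp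
  \<comment> \<open>If \<open>e' 0 = 0\<close>, then \<open>r 0 = 0\<close> by the convention for division by zero.\<close>
  define r where "r x = (if x = 0 then q' 0 / e' 0 else q x / e x)" for x
  have r0: "r 0 * e' 0 = q' 0" using q'0 by (auto simp: r_def)
  have r_bound: "\<bar>r x\<bar> \<le> \<bar>K\<bar>" if "x \<in> {0<..X}" for x
  proof -
    have "\<bar>q x\<bar> \<le> \<bar>K\<bar> * e x"
      using cone[OF that] mult_right_mono[OF abs_ge_self, of "e x" K] e_pos[OF that] by linarith
    then show ?thesis using e_pos[OF that] that by (simp add: r_def abs_divide divide_le_eq)
  qed
  \<comment> \<open>When \<open>e' 0 = 0\<close> the ratio \<open>r\<close> may oscillate near 0, so
    no limit of \<open>r\<close> alone is claimed. It suffices to treat products with a factor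
    \<open>f\<close> that tends to 0 in this case.\<close>
  have r_mult: "((\<lambda>x. r x * f x) \<longlongrightarrow> r 0 * l) ?F"
    if f: "(f \<longlongrightarrow> l) ?F" and l: "e' 0 = 0 \<Longrightarrow> l = 0" for f l
  proof (cases "e' 0 = 0")
    case True
    have "((\<lambda>x. \<bar>K\<bar> * \<bar>f x\<bar>) \<longlongrightarrow> 0) ?F"
      by (intro tendsto_mult_right_zero tendsto_rabs_zero) (use f l[OF True] in simp)
    then have "((\<lambda>x. r x * f x) \<longlongrightarrow> 0) ?F"
      by (rule Lim_null_comparison[rotated, where g = "\<lambda>x. \<bar>K\<bar> * \<bar>f x\<bar>"])
         (rule ev, simp add: abs_mult mult_right_mono r_bound)
    then show ?thesis using l[OF True] by simp
  next
    case False
    have "((\<lambda>x. (q x / x) / (e x / x)) \<longlongrightarrow> q' 0 / e' 0) ?F"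
      by (rule tendsto_divide[OF lq le False])
    moreover have "\<forall>\<^sub>F x in ?F. (q x / x) / (e x / x) = r x"
      by (rule ev) (simp add: r_def)
    ultimately have "(r \<longlongrightarrow> q' 0 / e' 0) ?F" by (rule Lim_transform_eventually)
    then have "(r \<longlongrightarrow> r 0) ?F" by (simp add: r_def)
    then show ?thesis using f by (rule tendsto_mult)
  qed
  \<comment> \<open>The term \<open>r^2 * e'\<close> is bracketed as \<open>r * (r * e')\<close> so
    that \<open>r_mult\<close> applies twice: the inner limit \<open>r 0 * e' 0\<close> again
    vanishes when \<open>e' 0 = 0\<close>.\<close>
  define h where "h x = 2 * (r x * q' x) - r x * (r x * e' x)" for x
  have lim': "(e' \<longlongrightarrow> e' 0) ?F" "(q' \<longlongrightarrow> q' 0) ?F"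
    using c' X by (auto simp: continuous_on_def)
  have "(h \<longlongrightarrow> h 0) ?F"
    unfolding h_def by (intro tendsto_diff tendsto_mult_left r_mult lim') (auto simp: q'0)
  moreover have "(h \<longlongrightarrow> h x) (at x within {0..X})" if "x \<in> {0<..X}" for x
  proof -
    have x: "x \<in> {0..X}" "x \<noteq> 0" "e x \<noteq> 0" using that e_pos[OF that] by auto
    have lims: "(e \<longlongrightarrow> e x) (at x within {0..X})" "(q \<longlongrightarrow> q x) (at x within {0..X})"
      "(e' \<longlongrightarrow> e' x) (at x within {0..X})" "(q' \<longlongrightarrow> q' x) (at x within {0..X})"
      using cont c' x by (auto simp: continuous_on_def)
    have "((\<lambda>y. q y / e y) \<longlongrightarrow> q x / e x) (at x within {0..X})"
      by (intro tendsto_divide lims x)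
    moreover have "\<forall>\<^sub>F y in at x within {0..X}. q y / e y = r y"
      using eventually_neq_at_within[of 0 x "{0..X}"] by (rule eventually_mono) (simp add: r_def)
    ultimately have "(r \<longlongrightarrow> q x / e x) (at x within {0..X})"
      by (rule Lim_transform_eventually)
    then have "(r \<longlongrightarrow> r x) (at x within {0..X})"
      using x by (simp add: r_def)
    then show ?thesis unfolding h_def by (intro tendsto_diff tendsto_mult tendsto_const lims)
  qed
  ultimately have "continuous_on {0..X} h"
    unfolding continuous_on_def by (force simp: le_less)
  moreover have "((\<lambda>x. (q x)^2 / e x) has_real_derivative h x) (at x within {0..X})"
    if "x \<in> {0..X}" for x
  proof (cases "x = 0")
    case True
    \<comment> \<open>As \<open>q 0 = 0\<close>, the difference quotient at 0 is
      \<open>r x * (q x / x)\<close>. Its limit is \<open>h 0\<close> because \<open>r0\<close>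
      turns \<open>r 0 * (r 0 * e' 0)\<close> into one copy of \<open>r 0 * q' 0\<close>.\<close>
    have "((\<lambda>x. r x * (q x / x)) \<longlongrightarrow> r 0 * q' 0) ?F"
      by (intro r_mult lq q'0)
    then have "((\<lambda>x. (q x)^2 / e x / x) \<longlongrightarrow> r 0 * q' 0) ?F"
      by (rule Lim_transform_eventually) (auto intro!: ev simp: r_def power2_eq_square)
    moreover have "h 0 = r 0 * q' 0" by (simp add: h_def r0)
    ultimately show ?thesis using True by (simp add: has_field_derivative_iff q0)
  next
    case False
    then have "x \<in> {0<..X}" using that by auto
    then have e: "e x \<noteq> 0" using e_pos by force
    have "((\<lambda>x. (q x)^2 / e x) has_real_derivative
        (2 * q x * q' x * e x - (q x)^2 * e' x) / (e x * e x)) (at x within {0..X})"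
      using dq[OF that] de[OF that] e by (auto intro!: derivative_eq_intros)
    moreover have "(2 * q x * q' x * e x - (q x)^2 * e' x) / (e x * e x) = h x"
      using False e by (simp add: h_def r_def field_simps power2_eq_square)
    ultimately show ?thesis by simp
  qed
  ultimately show ?thesis
    unfolding C1_on_def has_real_derivative_iff_has_vector_derivative by blast
qed

section \<open>The fourth moment in the variables \<open>(M0, M1, e, q)\<close>\<close>

text \<open>On the frontier \<open>e = 0\<close> the quotient \<open>q^2 / e\<close> takes its limiting value 0, since \<open>x / 0 = 0\<close>.\<close>

definition M4_ext :: "real^4 \<Rightarrow> real" where
  "M4_ext M = ((e_var M)^2 + (q_var M)^2 / e_var M + 4 * M $ 1 * q_var M
     + 6 * (M $ 1)^2 * e_var M + (M $ 1)^4) / (M $ 0)^3"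

definition flux_ext :: "real^4 \<Rightarrow> real^4" where
  "flux_ext M = (\<chi> i. if i = 3 then M4_ext M else M $ (i + 1))"

lemma M4_bar_quadrature:
  assumes "quadrature M \<rho>1 \<rho>2 v1 v2"
  shows "M4_bar M = \<rho>1 * v1 ^ 4 + \<rho>2 * v2 ^ 4"
  unfolding M4_bar_def
proof (rule the_equality)
  show "\<exists>\<sigma>1 \<sigma>2 w1 w2. quadrature M \<sigma>1 \<sigma>2 w1 w2 \<and>
      \<rho>1 * v1 ^ 4 + \<rho>2 * v2 ^ 4 = \<sigma>1 * w1 ^ 4 + \<sigma>2 * w2 ^ 4"
    using assms by blast
qed (use quadrature_unique[OF assms] in blast)

text \<open>For the normalised pair of point masses, \<open>e\<close> is \<open>M0^2\<close> times
  the variance and \<open>q\<close> is \<open>M0^3\<close> times the third centred moment. Both are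
  multiples of powers of \<open>v1 - v2\<close>, and the denominator of \<open>q^2 / e\<close>
  cancels; what remains is a polynomial identity in weights and nodes.\<close>

lemma M4_ext_eq_M4_bar:
  assumes "M \<in> moment_space"
  shows "M4_ext M = M4_bar M"
proof -
  obtain \<rho>1 \<rho>2 v1 v2 where Q: "quadrature M \<rho>1 \<rho>2 v1 v2"
    using quadrature_exists[OF assms] by blast
  then have pos: "\<rho>1 > 0" "\<rho>2 > 0" "v1 - v2 > 0"
    and M: "M $ 0 = \<rho>1 + \<rho>2" "M $ 1 = \<rho>1 * v1 + \<rho>2 * v2"
      "M $ 2 = \<rho>1 * v1^2 + \<rho>2 * v2^2" "M $ 3 = \<rho>1 * v1^3 + \<rho>2 * v2^3"
    by (auto simp: quadrature_iff)
  have e: "e_var M = \<rho>1 * \<rho>2 * (v1 - v2)^2"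
    unfolding e_var_def M by algebra
  have q: "q_var M = \<rho>1 * \<rho>2 * (\<rho>2 - \<rho>1) * (v1 - v2)^3"
    unfolding q_var_def M by algebra
  have "(q_var M)^2 = \<rho>1 * \<rho>2 * (\<rho>2 - \<rho>1)^2 * (v1 - v2)^4 * e_var M"
    unfolding e q by algebra
  moreover have "e_var M \<noteq> 0" using pos by (simp add: e)
  ultimately have qe: "(q_var M)^2 / e_var M = \<rho>1 * \<rho>2 * (\<rho>2 - \<rho>1)^2 * (v1 - v2)^4"
    by simp
  have "(e_var M)^2 + (q_var M)^2 / e_var M + 4 * M $ 1 * q_var M
      + 6 * (M $ 1)^2 * e_var M + (M $ 1)^4 = (\<rho>1 * v1 ^ 4 + \<rho>2 * v2 ^ 4) * (M $ 0)^3"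
    \<comment> \<open>\<open>qe\<close> is unfolded first, so that the quotient is gone before
      \<open>e_var M\<close> is expanded and \<open>algebra\<close> meets only polynomials.\<close>
    unfolding qe unfolding e q M by algebra
  moreover have "M $ 0 \<noteq> 0" using pos M by simp
  ultimately show ?thesis by (simp add: M4_ext_def M4_bar_quadrature[OF Q])
qed

lemma flux_ext_eq_flux: "M \<in> moment_space \<Longrightarrow> flux_ext M = flux M"
  by (simp add: flux_ext_def flux_def M4_ext_eq_M4_bar cong: if_cong)

text \<open>The term singular on the frontier is isolated as the hypothesis \<open>sing\<close>,
  which regular paths and rays discharge differently; all else is polynomial in the moments up to
  division by a power of \<open>M0\<close>.\<close>

lemma C1_on_flux_ext:
  assumes "C1_on S M" and "\<And>x. x \<in> S \<Longrightarrow> M x $ 0 \<noteq> 0"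
    and sing: "C1_on S (\<lambda>x. (q_var (M x))^2 / e_var (M x))"
  shows "C1_on S (\<lambda>x. flux_ext (M x))"
proof -
  have [intro]: "C1_on S (\<lambda>x. M x $ i)" for i
    using assms(1) by (simp add: C1_on_vec_iff)
  have "C1_on S (\<lambda>x. e_var (M x))" "C1_on S (\<lambda>x. q_var (M x))"
    unfolding e_var_def q_var_def by (intro C1_on_intros; blast)+
  then have "C1_on S (\<lambda>x. M4_ext (M x))"
    unfolding M4_ext_def using assms(2) by (intro C1_on_intros sing) auto
  then have "C1_on S (\<lambda>x. flux_ext (M x) $ i)" for i
    unfolding flux_ext_def by (cases "i = 3") auto
  then show ?thesis by (simp add: C1_on_vec_iff)
qed

lemma C1_on_flux_ext_regular_path:
  assumes "regular_path \<eta> X M"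
  shows "C1_on {0..X} (\<lambda>x. flux_ext (M x))"
proof -
  note R = assms[unfolded regular_path_def]
  have X: "X > 0" and M: "C1_on {0..X} M" and e0: "e_var (M 0) = 0"
    and e: "\<And>x. x \<in> {0<..X} \<Longrightarrow> e_var (M x) > 0"
    and cone: "\<And>x. x \<in> {0<..X} \<Longrightarrow> \<bar>q_var (M x) / (M x $ 0 * e_var (M x))\<bar> \<le> \<eta>"
    using R by auto
  have M0: "M x $ 0 > 0" if "x \<in> {0..X}" for x using R that by force
  have [intro]: "C1_on {0..X} (\<lambda>x. M x $ i)" for i
    using M by (simp add: C1_on_vec_iff)
  \<comment> \<open>With denominator \<open>M0 * e\<close> instead of \<open>e\<close>, the cone
    condition supplies \<open>K = \<eta>\<close> directly; the factor \<open>M0\<close> is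
    multiplied back afterwards.\<close>
  have "C1_on {0..X} (\<lambda>x. (q_var (M x))^2 / (M x $ 0 * e_var (M x)))"
  proof (rule C1_on_square_divide[where K = \<eta>])
    show "C1_on {0..X} (\<lambda>x. M x $ 0 * e_var (M x))" "C1_on {0..X} (\<lambda>x. q_var (M x))"
      unfolding e_var_def q_var_def by (intro C1_on_intros; blast)+
    fix x assume x: "x \<in> {0<..X}"
    show pos: "M x $ 0 * e_var (M x) > 0" using M0 e x by simp
    show "\<bar>q_var (M x)\<bar> \<le> \<eta> * (M x $ 0 * e_var (M x))"
      using cone[OF x] pos by (simp add: abs_divide divide_le_eq)
  qed (use X e0 in auto)
  then have "C1_on {0..X} (\<lambda>x. M x $ 0 * ((q_var (M x))^2 / (M x $ 0 * e_var (M x))))"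
    by (intro C1_on_mult) auto
  \<comment> \<open>The cancellation of \<open>M0\<close> is valid at \<open>x = 0\<close> too,
    where both quotients are 0 by division by zero.\<close>
  then have "C1_on {0..X} (\<lambda>x. (q_var (M x))^2 / e_var (M x))"
    by (rule C1_on_cong) (use M0 in force)
  with M show ?thesis using M0 by (intro C1_on_flux_ext) force+
qed

text \<open>\<open>q^2 / e\<close> is homogeneous of degree one in \<open>(e, q)\<close>, hence
  linear in \<open>t\<close> along a ray from the origin; the remaining terms of the flux are
  polynomials in \<open>t\<close>.\<close>

lemma C1_on_flux_ext_ray:
  assumes m0: "m0 > 0"
  shows "C1_on S (\<lambda>t. flux_ext (from_eq m0 m1 (t * a) (t * b)))"
proof (rule C1_on_flux_ext)
  have coords: "from_eq m0 m1 e q $ 0 = m0" "e_var (from_eq m0 m1 e q) = e"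
    "q_var (from_eq m0 m1 e q) = q" for e q
    using from_eq_iff[OF m0] by blast+
  show "from_eq m0 m1 (x * a) (x * b) $ 0 \<noteq> 0" for x
    using m0 by (simp add: coords)
  have "C1_on S (\<lambda>t. from_eq m0 m1 (t * a) (t * b) $ i)" for i
    unfolding from_eq_def using m0
    by (cases "i = 0"; cases "i = 1"; cases "i = 2") (auto intro!: C1_on_intros)
  then show "C1_on S (\<lambda>t. from_eq m0 m1 (t * a) (t * b))"
    by (simp add: C1_on_vec_iff)
  have "C1_on S (\<lambda>t. t * (b^2 / a))" by (intro C1_on_mult C1_on_ident C1_on_const)
  \<comment> \<open>At \<open>t = 0\<close> the quotient is \<open>0 / 0 = 0\<close>, so it agrees
    with the linear function there as well.\<close>
  then show "C1_on S (\<lambda>t. (q_var (from_eq m0 m1 (t * a) (t * b)))^2 /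
      e_var (from_eq m0 m1 (t * a) (t * b)))"
    by (rule C1_on_cong) (simp add: coords power2_eq_square)
qed

text \<open>\<open>flux\<close> is meaningful only on \<open>moment_space\<close>, so regularity up
  to the frontier is stated for an extension \<open>G\<close>. It is chosen before the path, so all
  paths and rays share its frontier values. The rays run in the \<open>(e, q)\<close> plane, with
  \<open>M0\<close> and \<open>M1\<close> frozen at the limit point of the path.\<close>

theorem proposition2p6:
  shows "\<exists>G :: real^4 \<Rightarrow> real^4.
    (\<forall>M\<in>moment_space. G M = flux M) \<and>
    (\<forall>\<eta> X M. regular_path \<eta> X M \<longrightarrow>
       continuous_on {0..X} (\<lambda>x. G (M x)) \<and>
       C1_on {0..X} (\<lambda>x. G (M x)) \<and>
       (\<forall>a b. a > 0 \<and> \<bar>b / (M 0 $ 0 * a)\<bar> \<le> \<eta> \<longrightarrow>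
          C1_on {0..} (\<lambda>t. G (from_eq (M 0 $ 0) (M 0 $ 1) (t * a) (t * b)))))"
proof (intro exI[of _ flux_ext] conjI allI impI ballI)
  show "flux_ext M = flux M" if "M \<in> moment_space" for M
    using that by (rule flux_ext_eq_flux)
  fix \<eta> X M assume R: "regular_path \<eta> X M"
  show C1: "C1_on {0..X} (\<lambda>x. flux_ext (M x))"
    using R by (rule C1_on_flux_ext_regular_path)
  then show "continuous_on {0..X} (\<lambda>x. flux_ext (M x))"
    by (rule C1_on_imp_continuous_on)
  have "M 0 $ 0 > 0" using R by (force simp: regular_path_def)
  then show "C1_on {0..} (\<lambda>t. flux_ext (from_eq (M 0 $ 0) (M 0 $ 1) (t * a) (t * b)))" for a b
    by (rule C1_on_flux_ext_ray)
qed

end
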